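(* Let $T\in\mathbb{R}^{n\times n}$ be irreducible and $b\in\mathbb{R}^n$, and consider the iteration $$P^0=O,\qquad (I-P^k+TP^k)\,x^{k+1}=b,\qquad P^{k+1}=P(x^{k+1}),\qquad k=0,1,\dots .$$ Assume that either $T$ satisfies property (T1), or $T$ satisfies property (T2) and $v^Tb\le 0$. Then $$P^{k+1}\ge P^k\ge O$$ for $k=0,1,\dots$ (for every $k$ for which the iterates $x^1,\dots,x^{k+1}$ are defined, i.e. for which the matrices $I-P^j+TP^j$, $0\le j\le k$, are nonsingular).
   Context: For $x\in\mathbb{R}^n$, $P(x)$ is the diagonal matrix $\mathrm{diag}(p(x_1),\dots,p(x_n))$ with $p(x_i)=1$ if $x_i\ge 0$ and $p(x_i)=0$ otherwise. The superscript $k$ is an iteration index, not a power. All inequalities between vectors or matrices are componentwise; $O$ is the zero matrix. An $M$-matrix is a real square matrix that can be written as $\alpha I-B$ with $B\ge O$ and spectral radius $\rho(B)<\alpha$. Property (T1): $T$ is an $M$-matrix. Property (T2): $\mathrm{null}(T^T)=\mathrm{span}(v)$ and $\mathrm{null}(T)=\mathrm{span}(w)$ for some vectors $v,w>0$ (componentwise), and $T+D$ is an $M$-matrix for every diagonal matrix $D\ge O$ with $D\ne O$. The vector $v$ in the claim is the one in (T2). *)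

theory Defs
  imports "Jordan_Normal_Form.Spectral_Radius" "Jordan_Normal_Form.Matrix_Kernel"
begin

text \<open>
  Matrices and vectors are those of the theory of Jordan normal forms, with indices
  \<open>0, \<dots>, n - 1\<close>; its orders \<open>\<le>\<close> on \<open>mat\<close> and \<open>vec\<close> are componentwise. Its strict order
  \<open><\<close> on vectors is not, so strict positivity of vectors is introduced separately.
\<close>

definition positive_vec :: "real vec \<Rightarrow> bool" where
  "positive_vec v \<longleftrightarrow> (\<forall>i<dim_vec v. 0 < v $ i)"

text \<open>
  A square matrix is reducible if a simultaneous permutation of its rows and columns
  brings it to block upper triangular form with two nonempty square diagonal blocks, the first
  one of size \<open>r\<close>. In particular every \<open>1 \<times> 1\<close> matrix is irreducible.
\<close>

definition reducible_mat :: "'a :: zero mat \<Rightarrow> bool" where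
  "reducible_mat A \<longleftrightarrow>
     (\<exists>p r. p permutes {..<dim_row A} \<and> 0 < r \<and> r < dim_row A \<and>
        (\<forall>i j. r \<le> i \<and> i < dim_row A \<and> j < r \<longrightarrow> A $$ (p i, p j) = 0))"

definition irreducible_mat :: "'a :: zero mat \<Rightarrow> bool" where
  "irreducible_mat A \<longleftrightarrow> square_mat A \<and> \<not> reducible_mat A"

text \<open>
  The spectral radius ranges over the complex eigenvalues. It is a maximum over the
  spectrum and is therefore meaningful only for dimension at least one.
\<close>

definition M_matrix :: "real mat \<Rightarrow> bool" where
  "M_matrix A \<longleftrightarrow> square_mat A \<and>
     (\<exists>\<alpha> B. B \<in> carrier_mat (dim_row A) (dim_row A) \<and>
        0\<^sub>m (dim_row A) (dim_row A) \<le> B \<and>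
        spectral_radius (map_mat complex_of_real B) < \<alpha> \<and>
        A = \<alpha> \<cdot>\<^sub>m 1\<^sub>m (dim_row A) - B)"

abbreviation vec_span :: "nat \<Rightarrow> real vec set \<Rightarrow> real vec set" where
  "vec_span n \<equiv> LinearCombinations.module.span class_ring (module_vec TYPE(real) n)"

definition property_T1 :: "real mat \<Rightarrow> bool" where
  "property_T1 T \<longleftrightarrow> M_matrix T"

text \<open>The vector \<open>v\<close> is a parameter since it occurs in the statements that use this property.\<close>

definition property_T2 :: "real mat \<Rightarrow> real vec \<Rightarrow> bool" where
  "property_T2 T v \<longleftrightarrow> square_mat T \<and>
     (v \<in> carrier_vec (dim_row T) \<and> positive_vec v \<and>
      mat_kernel (transpose_mat T) = vec_span (dim_row T) {v}) \<and>
     (\<exists>w \<in> carrier_vec (dim_row T). positive_vec w \<and>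
      mat_kernel T = vec_span (dim_row T) {w}) \<and>
     (\<forall>D \<in> carrier_mat (dim_row T) (dim_row T).
        diagonal_mat D \<and> 0\<^sub>m (dim_row T) (dim_row T) \<le> D \<and> D \<noteq> 0\<^sub>m (dim_row T) (dim_row T)
        \<longrightarrow> M_matrix (T + D))"

definition sign_mat :: "real vec \<Rightarrow> real mat" where
  "sign_mat x = mat_diag (dim_vec x) (\<lambda>i. if 0 \<le> x $ i then 1 else 0)"

abbreviation iter_mat :: "real mat \<Rightarrow> real mat \<Rightarrow> real mat" where
  "iter_mat T P \<equiv> 1\<^sub>m (dim_row T) - P + T * P"

end

theory Submission
  imports Defs
begin

text \<open>
  Let \<open>S\<^sub>k\<close> be the set of indices with a one on the diagonal of \<open>P\<^sup>k\<close>. With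
  \<open>y\<^sup>k = P\<^sup>k x\<^sup>k\<^sup>+\<^sup>1\<close> the defining equation of the iterate reads
  \<open>(T y\<^sup>k)\<^sub>i = b\<^sub>i\<close> for \<open>i \<in> S\<^sub>k\<close> and \<open>x\<^sup>k\<^sup>+\<^sup>1\<^sub>i + (T y\<^sup>k)\<^sub>i = b\<^sub>i\<close> for the other \<open>i\<close>.
  The claim is that \<open>x\<^sup>k\<^sup>+\<^sup>1\<close> is nonnegative on \<open>S\<^sub>k\<close>, that is \<open>S\<^sub>k \<subseteq> S\<^sub>k\<^sub>+\<^sub>1\<close>, and it goes by induction
  on \<open>k\<close>. If \<open>S\<^sub>k \<subseteq> S\<^sub>k\<^sub>+\<^sub>1\<close>, then on \<open>S\<^sub>k\<^sub>+\<^sub>1\<close>, where \<open>x\<^sup>k\<^sup>+\<^sup>1\<close> is nonnegative, subtracting the two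
  equations gives \<open>T (y\<^sup>k\<^sup>+\<^sup>1 - y\<^sup>k) \<ge> 0\<close>; the vector \<open>y\<^sup>k\<^sup>+\<^sup>1 - y\<^sup>k\<close> lives on \<open>S\<^sub>k\<^sub>+\<^sub>1\<close>. If the principal
  block of \<open>T\<close> on \<open>S\<^sub>k\<^sub>+\<^sub>1\<close> is monotone, it follows that \<open>y\<^sup>k\<^sup>+\<^sup>1 \<ge> y\<^sup>k \<ge> 0\<close>, and \<open>y\<^sup>k\<^sup>+\<^sup>1\<close> agrees with
  \<open>x\<^sup>k\<^sup>+\<^sup>2\<close> on \<open>S\<^sub>k\<^sub>+\<^sub>1\<close>. This is \<open>next_iterate_nonneg_on_support\<close>.

  It remains to see that the blocks are monotone. Every principal block of an \<open>M\<close>-matrix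
  \<open>\<alpha> I - B\<close> is (\<open>M_matrix_block_monotone\<close>): the negative part \<open>u\<close> of a counterexample would be a
  nonzero nonnegative vector with \<open>B u \<ge> \<alpha> u\<close>, which forces \<open>\<rho>(B) \<ge> \<alpha>\<close>
  (\<open>le_spectral_radius_if_subeigenvector\<close>). Under the property (T2) a proper principal block of
  \<open>T\<close> is also a block of the \<open>M\<close>-matrix \<open>T + D\<close>, where \<open>D\<close> is the diagonal indicator of the
  complement (\<open>T2_block_monotone\<close>); the full block would make the iteration matrix equal to
  \<open>T\<close>, which is singular (\<open>T2_singular\<close>) and hence excluded by the assumption that the iterates are
  defined.
\<close>

section \<open>Nonnegative matrices and the spectral radius\<close>

lemma index_mult_mat_vec_sum:
  assumes "A \<in> carrier_mat n n" "x \<in> carrier_vec n" "i < n"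
  shows "(A *\<^sub>v x) $ i = (\<Sum>j<n. A $$ (i, j) * x $ j)"
  using assms by (auto simp: scalar_prod_def atLeast0LessThan)

lemma nonneg_mat_iff:
  fixes A :: "real mat"
  assumes "A \<in> carrier_mat n n"
  shows "0\<^sub>m n n \<le> A \<longleftrightarrow> (\<forall>i<n. \<forall>j<n. 0 \<le> A $$ (i, j))"
  using assms by (auto simp: less_eq_mat_def)

lemma nonneg_mult_mat_vec_mono:
  fixes A :: "real mat"
  assumes "A \<in> carrier_mat n n" "0\<^sub>m n n \<le> A"
    and "x \<in> carrier_vec n" "y \<in> carrier_vec n" "x \<le> y"
  shows "A *\<^sub>v x \<le> A *\<^sub>v y"
proof -
  have "(A *\<^sub>v x) $ i \<le> (A *\<^sub>v y) $ i" if "i < n" for i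
    unfolding index_mult_mat_vec_sum[OF assms(1,3) that] index_mult_mat_vec_sum[OF assms(1,4) that]
    using assms that by (intro sum_mono mult_left_mono) (auto simp: less_eq_vec_def less_eq_mat_def)
  then show ?thesis
    using assms(1) by (auto simp: less_eq_vec_def)
qed

lemma nonneg_pow_mat:
  fixes A :: "real mat"
  assumes A: "A \<in> carrier_mat n n" "0\<^sub>m n n \<le> A"
  shows "0\<^sub>m n n \<le> A ^\<^sub>m m"
proof (induction m)
  case 0
  then show ?case using A by (auto simp: less_eq_mat_def)
next
  case (Suc m)
  have Am: "A ^\<^sub>m m \<in> carrier_mat n n" using A by simp
  have "0 \<le> (A ^\<^sub>m m * A) $$ (i, j)" if ij: "i < n" "j < n" for i j
  proof -
    have "(A ^\<^sub>m m * A) $$ (i, j) = (\<Sum>l<n. (A ^\<^sub>m m) $$ (i, l) * A $$ (l, j))"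
      using Am A(1) ij by (simp add: scalar_prod_def atLeast0LessThan)
    also have "\<dots> \<ge> 0"
      using Suc Am A ij by (intro sum_nonneg mult_nonneg_nonneg)
        (simp_all add: nonneg_mat_iff[OF Am] nonneg_mat_iff[OF A(1)])
    finally show ?thesis .
  qed
  then show ?case
    using nonneg_mat_iff[OF mult_carrier_mat[OF Am A(1)]] by simp
qed

text \<open>
  Multiplication by a nonnegative matrix preserves inequalities, so \<open>c u \<le> A u\<close> can be iterated.
\<close>

lemma pow_mat_mult_vec_ge:
  fixes A :: "real mat"
  assumes A: "A \<in> carrier_mat n n" "0\<^sub>m n n \<le> A"
    and u: "u \<in> carrier_vec n" and le: "c \<cdot>\<^sub>v u \<le> A *\<^sub>v u" and "0 \<le> c"
  shows "c ^ m \<cdot>\<^sub>v u \<le> A ^\<^sub>m m *\<^sub>v u"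
proof (induction m)
  case 0
  then show ?case using A u by simp
next
  case (Suc m)
  have Am: "A ^\<^sub>m m \<in> carrier_mat n n" using A by simp
  have "c ^ Suc m \<cdot>\<^sub>v u = c \<cdot>\<^sub>v (c ^ m \<cdot>\<^sub>v u)"
    by (simp add: smult_smult_assoc)
  also have "\<dots> \<le> c \<cdot>\<^sub>v (A ^\<^sub>m m *\<^sub>v u)"
    using Suc \<open>0 \<le> c\<close> by (auto simp: less_eq_vec_def intro: mult_left_mono)
  also have "\<dots> = A ^\<^sub>m m *\<^sub>v (c \<cdot>\<^sub>v u)"
    using Am u by (simp add: mult_mat_vec)
  also have "\<dots> \<le> A ^\<^sub>m m *\<^sub>v (A *\<^sub>v u)"
    using nonneg_mult_mat_vec_mono[OF Am nonneg_pow_mat[OF A]] A u le by simp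
  also have "\<dots> = A ^\<^sub>m Suc m *\<^sub>v u"
    using assoc_mult_mat_vec[OF Am A(1) u] by simp
  finally show ?case .
qed

text \<open>
  This normalization makes the boundedness of the powers of a matrix with spectral radius below
  one applicable.
\<close>

lemma spectral_radius_smult_less_1:
  assumes A: "A \<in> carrier_mat n n" and "0 < n" and "0 < \<beta>" and less: "spectral_radius A < \<beta>"
  shows "spectral_radius (complex_of_real (1 / \<beta>) \<cdot>\<^sub>m A) < 1"
proof -
  let ?C = "complex_of_real (1 / \<beta>) \<cdot>\<^sub>m A"
  have C: "?C \<in> carrier_mat n n" using A by simp
  obtain e where e: "eigenvalue ?C e" "spectral_radius ?C = norm e"
    using spectral_radius_mem_max(1)[OF C \<open>0 < n\<close>] by (auto simp: spectrum_def)
  then obtain w where w: "w \<in> carrier_vec n" "w \<noteq> 0\<^sub>v n" "?C *\<^sub>v w = e \<cdot>\<^sub>v w"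
    using A by (auto simp: eigenvalue_def eigenvector_def)
  have "A *\<^sub>v w = complex_of_real \<beta> \<cdot>\<^sub>v (?C *\<^sub>v w)"
    using A w(1) \<open>0 < \<beta>\<close> by (intro eq_vecI) auto
  also have "\<dots> = (of_real \<beta> * e) \<cdot>\<^sub>v w"
    unfolding w(3) by (simp add: smult_smult_assoc)
  finally have "eigenvalue A (of_real \<beta> * e)"
    using A w by (auto simp: eigenvalue_def eigenvector_def)
  then have "norm (of_real \<beta> * e) \<le> spectral_radius A"
    by (intro spectral_radius_mem_max(2)[OF A \<open>0 < n\<close>]) (auto simp: spectrum_def)
  then have "norm e * \<beta> \<le> spectral_radius A"
    using \<open>0 < \<beta>\<close> by (simp add: norm_mult mult.commute)
  also note less
  finally show ?thesis
    unfolding e(2) using \<open>0 < \<beta>\<close> by simp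
qed

text \<open>
  The Collatz--Wielandt lower bound for the Perron root. If it failed, then
  after scaling by some \<open>\<beta>\<close> strictly between \<open>\<rho>(B)\<close> and \<open>\<alpha>\<close> the powers of \<open>B / \<beta>\<close> would be bounded,
  while \<open>(B / \<beta>)\<^sup>m u \<ge> (\<alpha> / \<beta>)\<^sup>m u\<close> grows geometrically in every coordinate where \<open>u\<close> is positive.
\<close>

lemma le_spectral_radius_if_subeigenvector:
  fixes B :: "real mat"
  assumes B: "B \<in> carrier_mat n n" "0\<^sub>m n n \<le> B"
    and u: "u \<in> carrier_vec n" "0\<^sub>v n \<le> u" "u \<noteq> 0\<^sub>v n"
    and le: "\<alpha> \<cdot>\<^sub>v u \<le> B *\<^sub>v u"
  shows "\<alpha> \<le> spectral_radius (map_mat complex_of_real B)"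
proof (rule ccontr)
  let ?\<rho> = "spectral_radius (map_mat complex_of_real B)"
  assume "\<not> \<alpha> \<le> ?\<rho>"
  then obtain \<beta> where \<beta>: "?\<rho> < \<beta>" "\<beta> < \<alpha>" using dense[of ?\<rho> \<alpha>] by auto
  obtain i where i: "i < n" "u $ i \<noteq> 0" using u by (metis carrier_vecD eq_vecI index_zero_vec)
  then have n: "0 < n" and ui: "0 < u $ i" using u by (auto simp: less_eq_vec_def order_less_le)
  have Bc: "map_mat complex_of_real B \<in> carrier_mat n n" using B by simp
  have "0 \<le> ?\<rho>" using spectral_radius_mem_max(1)[OF Bc n] by auto
  then have "0 < \<beta>" using \<beta> by simp
  define C where "C = (1 / \<beta>) \<cdot>\<^sub>m B"
  define \<gamma> where "\<gamma> = \<alpha> / \<beta>"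
  have \<gamma>: "1 < \<gamma>" using \<beta> \<open>0 < \<beta>\<close> by (simp add: \<gamma>_def)
  have C: "C \<in> carrier_mat n n" "0\<^sub>m n n \<le> C"
    using B \<open>0 < \<beta>\<close> by (auto simp: C_def less_eq_mat_def)
  have "\<gamma> \<cdot>\<^sub>v u \<le> C *\<^sub>v u"
    using le B u(1) \<open>0 < \<beta>\<close> by (auto simp: C_def \<gamma>_def less_eq_vec_def divide_right_mono)
  then have ge: "\<gamma> ^ m \<cdot>\<^sub>v u \<le> C ^\<^sub>m m *\<^sub>v u" for m
    using pow_mat_mult_vec_ge[OF C u(1)] \<gamma> by simp
  have Cc: "map_mat complex_of_real C = complex_of_real (1 / \<beta>) \<cdot>\<^sub>m map_mat complex_of_real B"
    by (auto simp: C_def)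
  have "spectral_radius (map_mat complex_of_real C) < 1"
    unfolding Cc by (rule spectral_radius_smult_less_1[OF Bc n \<open>0 < \<beta>\<close> \<beta>(1)])
  then obtain c where c: "norm_bound (map_mat complex_of_real C ^\<^sub>m m) c" for m
    using spectral_radius_jnf_norm_bound_less_1_upper_triangular[of "map_mat complex_of_real C" n] C
    by auto
  have entry: "(C ^\<^sub>m m) $$ (i, j) \<le> c" if "j < n" for m j
  proof -
    have "norm (complex_of_real ((C ^\<^sub>m m) $$ (i, j))) \<le> c"
      using c[of m] that i C unfolding of_real_hom.mat_hom_pow[OF C(1), symmetric]
      by (auto simp: norm_bound_def pow_mat_dim)
    then show ?thesis by simp
  qed
  have bound: "\<gamma> ^ m * u $ i \<le> (\<Sum>j<n. c * u $ j)" for m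
  proof -
    have "\<gamma> ^ m * u $ i \<le> (C ^\<^sub>m m *\<^sub>v u) $ i"
      using ge[of m] i u C by (auto simp: less_eq_vec_def)
    also have "\<dots> = (\<Sum>j<n. (C ^\<^sub>m m) $$ (i, j) * u $ j)"
      using C u i by (intro index_mult_mat_vec_sum) auto
    also have "\<dots> \<le> (\<Sum>j<n. c * u $ j)"
      using entry u by (intro sum_mono mult_right_mono) (auto simp: less_eq_vec_def)
    finally show ?thesis .
  qed
  obtain m where "(\<Sum>j<n. c * u $ j) / u $ i < \<gamma> ^ m"
    using real_arch_pow[OF \<gamma>] by blast
  then show False
    using bound[of m] ui by (simp add: divide_less_eq)
qed

section \<open>Monotonicity of principal blocks\<close>

text \<open>
  The principal block of \<open>A\<close> with rows and columns in \<open>S\<close> maps only nonnegative vectors to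
  nonnegative vectors. Vectors on \<open>S\<close> are represented by vectors of full length that vanish outside
  \<open>S\<close>, which avoids renumbering the indices of submatrices.
\<close>

definition block_monotone :: "nat set \<Rightarrow> real mat \<Rightarrow> bool" where
  "block_monotone S A \<longleftrightarrow>
     (\<forall>z \<in> carrier_vec (dim_row A).
        (\<forall>i<dim_row A. i \<notin> S \<longrightarrow> z $ i = 0) \<and> (\<forall>i<dim_row A. i \<in> S \<longrightarrow> 0 \<le> (A *\<^sub>v z) $ i)
        \<longrightarrow> (\<forall>i<dim_row A. 0 \<le> z $ i))"

text \<open>
  For \<open>A = \<alpha> I - B\<close> and a vector \<open>z\<close> supported on \<open>S\<close> with \<open>A z \<ge> 0\<close> there, the negative
  part \<open>u\<close> of \<open>z\<close> satisfies \<open>\<alpha> u \<le> B u\<close>. Where \<open>z\<^sub>i < 0\<close>, the index lies in \<open>S\<close> and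
  \<open>\<alpha> z\<^sub>i \<ge> (B z)\<^sub>i \<ge> - (B u)\<^sub>i\<close>; elsewhere \<open>u\<^sub>i = 0\<close>. Since \<open>\<rho>(B) < \<alpha>\<close>, this is only possible
  for \<open>u = 0\<close>.
\<close>

lemma M_matrix_block_monotone:
  assumes "M_matrix A"
  shows "block_monotone S A"
  unfolding block_monotone_def
proof (intro ballI impI, elim conjE)
  define n where "n = dim_row A"
  fix z :: "real vec"
  assume "z \<in> carrier_vec (dim_row A)" and "\<forall>i<dim_row A. i \<notin> S \<longrightarrow> z $ i = 0"
    and "\<forall>i<dim_row A. i \<in> S \<longrightarrow> 0 \<le> (A *\<^sub>v z) $ i"
  then have z: "z \<in> carrier_vec n" "\<And>i. i < n \<Longrightarrow> i \<notin> S \<Longrightarrow> z $ i = 0"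
    "\<And>i. i < n \<Longrightarrow> i \<in> S \<Longrightarrow> 0 \<le> (A *\<^sub>v z) $ i"
    by (auto simp: n_def)
  obtain \<alpha> B where B: "B \<in> carrier_mat n n" "0\<^sub>m n n \<le> B"
    and less: "spectral_radius (map_mat complex_of_real B) < \<alpha>" and A: "A = \<alpha> \<cdot>\<^sub>m 1\<^sub>m n - B"
    using assms unfolding M_matrix_def n_def by auto
  have Az: "A *\<^sub>v z = \<alpha> \<cdot>\<^sub>v z - B *\<^sub>v z"
    using B z(1) by (auto simp: A minus_mult_distrib_mat_vec[of _ n n])
  define u where "u = vec n (\<lambda>i. max 0 (- z $ i))"
  have u: "u \<in> carrier_vec n" "0\<^sub>v n \<le> u" by (auto simp: u_def less_eq_vec_def)
  have "- z \<le> u" using z(1) by (auto simp: u_def less_eq_vec_def)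
  then have "B *\<^sub>v (- z) \<le> B *\<^sub>v u"
    using nonneg_mult_mat_vec_mono[OF B, of "- z" u] z(1) u(1) by simp
  then have neg: "- (B *\<^sub>v z) $ i \<le> (B *\<^sub>v u) $ i" if "i < n" for i
    using that B z(1) by (auto simp: less_eq_vec_def)
  have "B *\<^sub>v 0\<^sub>v n \<le> B *\<^sub>v u" using nonneg_mult_mat_vec_mono[OF B _ u(1) u(2)] by simp
  then have nonneg: "0 \<le> (B *\<^sub>v u) $ i" if "i < n" for i
    using that B by (auto simp: less_eq_vec_def)
  have "\<alpha> * u $ i \<le> (B *\<^sub>v u) $ i" if i: "i < n" for i
  proof (cases "z $ i < 0")
    case True
    then have "i \<in> S" using z(2)[OF i] by auto
    then have "(B *\<^sub>v z) $ i \<le> \<alpha> * z $ i"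
      using z(3)[OF i] i B z(1) by (simp add: Az)
    then show ?thesis using True neg[OF i] i by (simp add: u_def)
  next
    case False
    then show ?thesis using nonneg[OF i] i by (simp add: u_def)
  qed
  then have "\<alpha> \<cdot>\<^sub>v u \<le> B *\<^sub>v u" using B u by (auto simp: less_eq_vec_def)
  then have "u = 0\<^sub>v n"
    using le_spectral_radius_if_subeigenvector[OF B u] less by fastforce
  then have "max 0 (- z $ i) = 0" if "i < n" for i
    using that by (metis u_def index_vec index_zero_vec(1))
  then show "\<forall>i<dim_row A. 0 \<le> z $ i"
    unfolding n_def[symmetric] by (metis max.cobounded2 neg_le_0_iff_le)
qed

text \<open>
  Adding a diagonal matrix that vanishes on \<open>S\<close> does not change the block on \<open>S\<close>. Such a matrix can be
  chosen nonzero exactly because the index \<open>m\<close> is outside \<open>S\<close>.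
\<close>

lemma T2_block_monotone:
  assumes T: "T \<in> carrier_mat n n" and T2: "property_T2 T v" and m: "m < n" "m \<notin> S"
  shows "block_monotone S T"
proof -
  define D :: "real mat" where "D = mat_diag n (\<lambda>i. if i \<in> S then 0 else 1)"
  have D: "D \<in> carrier_mat n n" "diagonal_mat D" "0\<^sub>m n n \<le> D"
    by (auto simp: D_def mat_diag_def diagonal_mat_def less_eq_mat_def)
  have "D $$ (m, m) = 1" using m by (simp add: D_def mat_diag_def)
  then have "D \<noteq> 0\<^sub>m n n" using m by auto
  then have "M_matrix (T + D)" using T2 T D by (auto simp: property_T2_def)
  then have mono: "block_monotone S (T + D)" by (rule M_matrix_block_monotone)
  have row: "((T + D) *\<^sub>v z) $ i = (T *\<^sub>v z) $ i" if "z \<in> carrier_vec n" "i < n" "i \<in> S" for z i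
  proof -
    have "(D *\<^sub>v z) $ i = 0"
      unfolding index_mult_mat_vec_sum[OF D(1) that(1,2)]
      using that by (intro sum.neutral) (auto simp: D_def mat_diag_def)
    then show ?thesis using T D that by (simp add: add_mult_distrib_mat_vec[OF T D(1)])
  qed
  show ?thesis
    using mono T D(1) row unfolding block_monotone_def by simp
qed

text \<open>The positive vector that spans the kernel is nonzero as soon as the dimension is positive.\<close>

lemma T2_singular:
  assumes T: "T \<in> carrier_mat n n" and T2: "property_T2 T v" and "0 < n"
  shows "\<not> invertible_mat T"
proof
  assume "invertible_mat T"
  then obtain R where "T * R = 1\<^sub>m n" and RT: "R * T = 1\<^sub>m (dim_row R)"
    using T by (auto simp: invertible_mat_def inverts_mat_def)
  then have "dim_col R = n" "dim_row R = n"
    using T by (metis carrier_matD(2) index_mult_mat(3) index_one_mat(3))+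
  then have R: "R \<in> carrier_mat n n" by auto
  obtain w where w: "w \<in> carrier_vec n" "positive_vec w" and ker: "mat_kernel T = vec_span n {w}"
    using T2 T by (auto simp: property_T2_def)
  interpret vec_space "TYPE(real)" n .
  have "w \<in> mat_kernel T"
    unfolding ker using w(1) by (intro set_mp[OF in_own_span]) auto
  then have "T *\<^sub>v w = 0\<^sub>v n" using mat_kernelD[OF T] by simp
  then have "R * T *\<^sub>v w = 0\<^sub>v n"
    using R T w(1) assoc_mult_mat_vec[OF R T w(1)] by (intro eq_vecI) (auto simp: scalar_prod_def)
  then have "w = 0\<^sub>v n" using RT R w(1) by simp
  then show False using w \<open>0 < n\<close> by (auto simp: positive_vec_def)
qed

section \<open>The iteration\<close>

definition indicator_mat :: "nat \<Rightarrow> nat set \<Rightarrow> real mat" where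
  "indicator_mat n S = mat_diag n (\<lambda>i. if i \<in> S then 1 else 0)"

lemma indicator_mat_carrier [simp]: "indicator_mat n S \<in> carrier_mat n n"
  by (simp add: indicator_mat_def)

lemma dim_indicator_mat [simp]:
  "dim_row (indicator_mat n S) = n" "dim_col (indicator_mat n S) = n"
  by (simp_all add: indicator_mat_def mat_diag_def)

lemma indicator_mat_le_iff: "indicator_mat n S \<le> indicator_mat n S' \<longleftrightarrow> S \<inter> {..<n} \<subseteq> S'"
  by (auto simp: indicator_mat_def mat_diag_def less_eq_mat_def split: if_splits)

lemma indicator_mat_nonneg: "0\<^sub>m n n \<le> indicator_mat n S"
  by (auto simp: indicator_mat_def mat_diag_def less_eq_mat_def)

lemma sign_mat_eq_indicator_mat:
  "x \<in> carrier_vec n \<Longrightarrow> sign_mat x = indicator_mat n {i. 0 \<le> x $ i}"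
  by (auto simp: sign_mat_def indicator_mat_def)

lemma indicator_mat_mult_vec:
  assumes x: "x \<in> carrier_vec n" and i: "i < n"
  shows "(indicator_mat n S *\<^sub>v x) $ i = (if i \<in> S then x $ i else 0)"
proof -
  have "(indicator_mat n S *\<^sub>v x) $ i = (\<Sum>j<n. if i = j then (if j \<in> S then x $ j else 0) else 0)"
    unfolding index_mult_mat_vec_sum[OF indicator_mat_carrier x i]
    using i by (intro sum.cong) (auto simp: indicator_mat_def mat_diag_def)
  then show ?thesis using i by simp
qed

lemma iter_mat_mult_vec:
  assumes T: "T \<in> carrier_mat n n" and x: "x \<in> carrier_vec n" and i: "i < n"
  shows "(iter_mat T (indicator_mat n S) *\<^sub>v x) $ i =
    (if i \<in> S then 0 else x $ i) + (T *\<^sub>v (indicator_mat n S *\<^sub>v x)) $ i"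
proof -
  let ?P = "indicator_mat n S"
  have P: "?P \<in> carrier_mat n n" by simp
  have "iter_mat T ?P *\<^sub>v x = (x - ?P *\<^sub>v x) + T *\<^sub>v (?P *\<^sub>v x)"
  proof -
    have "iter_mat T ?P *\<^sub>v x = (1\<^sub>m n - ?P) *\<^sub>v x + T * ?P *\<^sub>v x"
      unfolding carrier_matD(1)[OF T]
      by (rule add_mult_distrib_mat_vec[OF minus_carrier_mat[OF P] mult_carrier_mat[OF T P] x])
    also have "(1\<^sub>m n - ?P) *\<^sub>v x = x - ?P *\<^sub>v x"
      unfolding minus_mult_distrib_mat_vec[OF one_carrier_mat P x] one_mult_mat_vec[OF x] ..
    also have "T * ?P *\<^sub>v x = T *\<^sub>v (?P *\<^sub>v x)"
      by (rule assoc_mult_mat_vec[OF T P x])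
    finally show ?thesis .
  qed
  then show ?thesis
    using T x i P by (simp add: indicator_mat_mult_vec del: index_mult_mat_vec)
qed

text \<open>
  The induction step. Here \<open>y\<close> and \<open>x\<close> are consecutive iterates, computed with the index sets \<open>S'\<close>
  and \<open>S\<close>. In a row \<open>j \<in> S\<close> the equation of \<open>x\<close> contains only \<open>T\<close> applied to the
  restriction of \<open>x\<close> to \<open>S\<close>, while that of \<open>y\<close> contains in addition the nonnegative term \<open>y\<^sub>j\<close> if
  \<open>j \<notin> S'\<close>. Thus the restrictions differ by a vector supported on \<open>S\<close> with nonnegative
  image there, and monotonicity of the block bounds \<open>x\<close> from below by the restriction of \<open>y\<close> to \<open>S'\<close>.
\<close>

lemma next_iterate_nonneg_on_support:
  assumes T: "T \<in> carrier_mat n n" and S'S: "S' \<subseteq> S"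
    and mono: "block_monotone S T"
    and y: "y \<in> carrier_vec n" "\<And>i. i < n \<Longrightarrow> i \<in> S \<Longrightarrow> 0 \<le> y $ i"
    and x: "x \<in> carrier_vec n"
    and eq: "iter_mat T (indicator_mat n S) *\<^sub>v x = iter_mat T (indicator_mat n S') *\<^sub>v y"
    and i: "i < n" "i \<in> S"
  shows "0 \<le> x $ i"
proof -
  let ?x = "indicator_mat n S *\<^sub>v x" and ?y = "indicator_mat n S' *\<^sub>v y"
  have carr: "?x \<in> carrier_vec n" "?y \<in> carrier_vec n"
    by (rule mult_mat_vec_carrier[OF indicator_mat_carrier x]
        mult_mat_vec_carrier[OF indicator_mat_carrier y(1)])+
  have out: "(?x - ?y) $ j = 0" if "j < n" "j \<notin> S" for j
  proof -
    have "j \<notin> S'" using that S'S by auto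
    then have "?x $ j = 0" "?y $ j = 0"
      using that by (simp_all add: indicator_mat_mult_vec[OF x] indicator_mat_mult_vec[OF y(1)]
        del: index_mult_mat_vec)
    then show ?thesis using that carr by (simp del: index_mult_mat_vec)
  qed
  have "0 \<le> (T *\<^sub>v (?x - ?y)) $ j" if j: "j < n" "j \<in> S" for j
  proof -
    have "(T *\<^sub>v ?x) $ j = (if j \<in> S' then 0 else y $ j) + (T *\<^sub>v ?y) $ j"
      using arg_cong[OF eq, of "\<lambda>w. w $ j"] j
      unfolding iter_mat_mult_vec[OF T x j(1)] iter_mat_mult_vec[OF T y(1) j(1)] by simp
    then show ?thesis
      using T j y(2)[OF j]
      by (simp add: mult_minus_distrib_mat_vec[OF T carr] del: index_mult_mat_vec)
  qed
  then have "0 \<le> (?x - ?y) $ i"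
    using mono[unfolded block_monotone_def, rule_format, of "?x - ?y" i] T carr out i
    by (simp del: index_mult_mat_vec index_minus_vec)
  then have "?y $ i \<le> ?x $ i"
    using i(1) carr by (simp del: index_mult_mat_vec)
  moreover have "0 \<le> ?y $ i"
    unfolding indicator_mat_mult_vec[OF y(1) i(1)] using y(2)[OF i] by simp
  ultimately show ?thesis
    unfolding indicator_mat_mult_vec[OF x i(1)] using i(2) by simp
qed

theorem theorem8:
  fixes n k :: nat and T :: "real mat" and b v :: "real vec"
    and x :: "nat \<Rightarrow> real vec" and P :: "nat \<Rightarrow> real mat"
  assumes "n \<ge> 1"
    and "T \<in> carrier_mat n n" and "b \<in> carrier_vec n"
    and "irreducible_mat T"
    and "property_T1 T \<or> (property_T2 T v \<and> v \<bullet> b \<le> 0)"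
    and "P 0 = 0\<^sub>m n n"
    and "\<And>j. j \<le> k \<Longrightarrow> invertible_mat (iter_mat T (P j))"
    and "\<And>j. j \<le> k \<Longrightarrow> x (j + 1) \<in> carrier_vec n \<and> iter_mat T (P j) *\<^sub>v x (j + 1) = b"
    and "\<And>j. j \<le> k \<Longrightarrow> P (j + 1) = sign_mat (x (j + 1))"
  shows "P (k + 1) \<ge> P k \<and> P k \<ge> 0\<^sub>m n n"
proof -
  \<comment> \<open>The start is a separate case, since \<open>P 0\<close> is zero and not the sign matrix of a vector.\<close>
  define S where "S j = (if j = 0 then {} else {i. i < n \<and> 0 \<le> x j $ i})" for j
  have P: "P j = indicator_mat n (S j)" if "j \<le> k + 1" for j
  proof (cases j)
    case 0
    then show ?thesis using assms(6) by (auto simp: S_def indicator_mat_def mat_diag_def)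
  next
    case (Suc l)
    then show ?thesis
      using that assms(8,9)[of l]
      by (auto simp: S_def sign_mat_eq_indicator_mat indicator_mat_def mat_diag_def)
  qed
  have mono: "block_monotone (S j) T" if "j \<le> k" for j
  proof (cases "property_T1 T")
    case True
    then show ?thesis by (simp add: property_T1_def M_matrix_block_monotone)
  next
    case False
    then have T2: "property_T2 T v" using assms(5) by simp
    have "\<exists>m<n. m \<notin> S j"
    proof (rule ccontr)
      assume "\<not> (\<exists>m<n. m \<notin> S j)"
      then have "P j = 1\<^sub>m n"
        using P[of j] that by (auto simp: indicator_mat_def mat_diag_def)
      then have "iter_mat T (P j) = T" using assms(2) by auto
      then show False
        using assms(1) assms(7)[of j] that T2_singular[OF assms(2) T2] by simp
    qed
    then show ?thesis using T2_block_monotone[OF assms(2) T2] by blast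
  qed
  have "S j \<subseteq> S (j + 1)" if "j \<le> k" for j
    using that
  proof (induction j)
    case 0
    then show ?case by (simp add: S_def)
  next
    case (Suc j)
    have xj: "x (j + 1) \<in> carrier_vec n" "iter_mat T (indicator_mat n (S j)) *\<^sub>v x (j + 1) = b"
      using assms(8)[of j] P[of j] Suc.prems by auto
    have xs: "x (Suc j + 1) \<in> carrier_vec n"
      "iter_mat T (indicator_mat n (S (j + 1))) *\<^sub>v x (Suc j + 1) = b"
      using assms(8)[of "Suc j"] P[of "Suc j"] Suc.prems by auto
    have "0 \<le> x (Suc j + 1) $ i" if "i \<in> S (j + 1)" for i
    proof (rule next_iterate_nonneg_on_support[OF assms(2) _ _ xj(1) _ xs(1)])
      show "S j \<subseteq> S (j + 1)" using Suc by simp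
      show "block_monotone (S (j + 1)) T" using mono[of "j + 1"] Suc.prems by simp
    qed (use xj(2) xs(2) that in \<open>auto simp: S_def\<close>)
    then show ?case by (auto simp: S_def)
  qed
  then show ?thesis
    using P[of k] P[of "k + 1"] by (auto simp: indicator_mat_le_iff indicator_mat_nonneg)
qed

end
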